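(* Let $\pi = 1 \oplus \rho$, where $\rho$ is a sum-indecomposable permutation that starts with an ascent (i.e. $\rho(1)<\rho(2)$). If $\rho$ has no increasing bond, or $\rho$ has no decreasing bond, then the class $\operatorname{Av}(\pi)$ is not deflatable.
   Context: A permutation $\alpha$ is contained in $\beta$ if $\beta$ has a subsequence in the same relative order as $\alpha$; a class is a set of permutations closed under taking contained permutations; $\operatorname{Av}(\pi)$ is the class of permutations not containing $\pi$. $\alpha\oplus\beta$ is the permutation consisting of a copy of $\alpha$ followed by a copy of $\beta$ whose entries are all larger than those of the copy of $\alpha$; a permutation is sum-indecomposable if it is not of the form $\alpha\oplus\beta$ with $\alpha,\beta$ nonempty. A bond of a permutation is a pair of entries in adjacent positions whose values differ by $1$; it is increasing if they form the pattern $12$ and decreasing if they form the pattern $21$. An interval of a permutation is a set of entries whose positions and values each form a set of consecutive integers, the whole permutation not counting as an interval; a permutation is simple if all its intervals are single entries (so $1$, $12$, $21$ are simple). A class $\mathcal{C}$ is deflatable if there is a proper subclass $\mathcal{D}\subsetneq\mathcal{C}$ with $\mathcal{C}\subseteq\langle\mathcal{D}\rangle$, where the substitution closure $\langle\mathcal{D}\rangle$ is the largest class whose simple permutations are exactly those of $\mathcal{D}$; equivalently, $\mathcal{C}$ is not deflatable if and only if every permutation in $\mathcal{C}$ is contained in some simple permutation belonging to $\mathcal{C}$. *)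

theory Defs
  imports Main "HOL-Library.Sublist"
begin

text \<open>
  Permutations are written in one-line notation as lists of the values \<open>1, \<dots>, n\<close>; list
  positions start at \<open>0\<close>, so the entry \<open>\<rho>(1)\<close> is \<open>\<rho> ! 0\<close>.  The empty
  permutation is admitted.
\<close>

definition is_perm :: "nat list \<Rightarrow> bool" where
  "is_perm xs \<longleftrightarrow> distinct xs \<and> set xs = {1..length xs}"

definition order_iso :: "nat list \<Rightarrow> nat list \<Rightarrow> bool" where
  "order_iso xs ys \<longleftrightarrow> length xs = length ys \<and>
     (\<forall>i<length xs. \<forall>j<length xs. xs ! i < xs ! j \<longleftrightarrow> ys ! i < ys ! j)"

definition contained_in :: "nat list \<Rightarrow> nat list \<Rightarrow> bool" where
  "contained_in \<alpha> \<beta> \<longleftrightarrow> (\<exists>s. subseq s \<beta> \<and> order_iso \<alpha> s)"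

definition perm_class :: "nat list set \<Rightarrow> bool" where
  "perm_class C \<longleftrightarrow> (\<forall>\<beta>\<in>C. is_perm \<beta>) \<and>
     (\<forall>\<beta>\<in>C. \<forall>\<alpha>. is_perm \<alpha> \<and> contained_in \<alpha> \<beta> \<longrightarrow> \<alpha> \<in> C)"

definition Av :: "nat list \<Rightarrow> nat list set" where
  "Av \<pi> = {\<sigma>. is_perm \<sigma> \<and> \<not> contained_in \<pi> \<sigma>}"

definition perm_sum :: "nat list \<Rightarrow> nat list \<Rightarrow> nat list" where
  "perm_sum \<alpha> \<beta> = \<alpha> @ map (\<lambda>y. length \<alpha> + y) \<beta>"

definition sum_indecomposable :: "nat list \<Rightarrow> bool" where
  "sum_indecomposable \<sigma> \<longleftrightarrow>
     \<not> (\<exists>\<alpha> \<beta>. is_perm \<alpha> \<and> is_perm \<beta> \<and> \<alpha> \<noteq> [] \<and> \<beta> \<noteq> [] \<and> \<sigma> = perm_sum \<alpha> \<beta>)"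

text \<open>A bond is identified by the position \<open>i\<close> of the first of its two entries.\<close>

definition bond :: "nat list \<Rightarrow> nat \<Rightarrow> bool" where
  "bond \<sigma> i \<longleftrightarrow> Suc i < length \<sigma> \<and> \<bar>int (\<sigma> ! Suc i) - int (\<sigma> ! i)\<bar> = 1"

definition increasing_bond :: "nat list \<Rightarrow> nat \<Rightarrow> bool" where
  "increasing_bond \<sigma> i \<longleftrightarrow> bond \<sigma> i \<and> \<sigma> ! i < \<sigma> ! Suc i"

definition decreasing_bond :: "nat list \<Rightarrow> nat \<Rightarrow> bool" where
  "decreasing_bond \<sigma> i \<longleftrightarrow> bond \<sigma> i \<and> \<sigma> ! Suc i < \<sigma> ! i"

text \<open>
  A set of entries is given by its set \<open>I\<close> of positions.  Intervals are nonempty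
  (\<open>a \<le> b\<close>) and, by the strict inclusion, different from the whole permutation.
\<close>

definition perm_interval :: "nat list \<Rightarrow> nat set \<Rightarrow> bool" where
  "perm_interval \<sigma> I \<longleftrightarrow> I \<subset> {..<length \<sigma>} \<and>
     (\<exists>a b. a \<le> b \<and> I = {a..b}) \<and> (\<exists>c d. (\<lambda>i. \<sigma> ! i) ` I = {c..d})"

definition simple_perm :: "nat list \<Rightarrow> bool" where
  "simple_perm \<sigma> \<longleftrightarrow> is_perm \<sigma> \<and> (\<forall>I. perm_interval \<sigma> I \<longrightarrow> card I = 1)"

definition simples :: "nat list set \<Rightarrow> nat list set" where
  "simples C = {\<sigma> \<in> C. simple_perm \<sigma>}"

text \<open>
  The largest class with the same simple permutations as \<open>D\<close>, obtained as the union of all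
  such classes; the two lemmas below show that this union is indeed the largest of them.
\<close>

definition subst_closure :: "nat list set \<Rightarrow> nat list set" where
  "subst_closure D = \<Union> {E. perm_class E \<and> simples E = simples D}"

lemma subst_closure_class:
  assumes "perm_class D"
  shows "perm_class (subst_closure D)" and "simples (subst_closure D) = simples D"
proof -
  show "perm_class (subst_closure D)"
    unfolding subst_closure_def perm_class_def by blast
  have "D \<subseteq> subst_closure D"
    using assms unfolding subst_closure_def by blast
  then show "simples (subst_closure D) = simples D"
    unfolding subst_closure_def simples_def by blast
qed

lemma subst_closure_largest:
  assumes "perm_class E" and "simples E = simples D"
  shows "E \<subseteq> subst_closure D"
  using assms unfolding subst_closure_def by blast

definition deflatable :: "nat list set \<Rightarrow> bool" where
  "deflatable C \<longleftrightarrow> (\<exists>D. perm_class D \<and> D \<subset> C \<and> C \<subseteq> subst_closure D)"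

end

theory Submission
  imports Defs Complex_Main
begin

text \<open>
  It suffices to embed every permutation \<open>\<sigma>\<close> avoiding \<open>\<pi> = 1 \<oplus> \<rho>\<close> into a simple one avoiding
  \<open>\<pi>\<close>.  View permutations as finite point sets in the plane; \<open>\<pi>\<close> is avoided iff no point has a
  copy of \<open>\<rho>\<close> to its north-east.  Any proper interval \<open>I\<close> with at least two points can be cut by
  one new point \<open>p\<close> that is separated from \<open>I\<close> by some old point outside \<open>I\<close>:

  \<^item> If some points are south-west of \<open>I\<close>, let \<open>m\<close> be the leftmost of them, and put \<open>p\<close> just to the
    left of \<open>m\<close> at a height inside \<open>I\<close>.  Nothing is south-west of \<open>p\<close>, and all that is north-east
    of \<open>p\<close> is north-east of \<open>m\<close>.
  \<^item> Otherwise, if some points are north-east of \<open>I\<close>, let \<open>t\<close> be the leftmost of them, and put \<open>p\<close>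
    just to the right of the leftmost point of \<open>I\<close>, at a height just above or just below \<open>t\<close>.  A
    copy of \<open>\<pi>\<close> must then use \<open>p\<close> and \<open>t\<close> as a bond, decreasing or increasing respectively.
    (If no height between \<open>I\<close> and \<open>t\<close> is occupied, then \<open>p\<close> just below \<open>t\<close> would not be separated
    from \<open>I\<close>, but \<open>p\<close> just above \<open>t\<close> works for every \<open>\<rho>\<close>, since \<open>p\<close> and \<open>t\<close> could only
    start a copy of \<open>\<rho>\<close>, with a descent.)
  \<^item> Otherwise \<open>p\<close> can be placed with only two points to its north-east, while \<open>\<rho>\<close> has length at
    least 3.

  Since \<open>p\<close> and an old point enter the interval spanned by any two points of \<open>I\<close>, the number of
  points outside the spanned interval of a given pair decreases, so that finitely many steps make
  any two points of \<open>\<sigma>\<close> span an interval containing \<open>\<sigma>\<close>.  A smallest extension with this property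
  is simple, because a proper interval could either be contracted to a point or replace the whole.
\<close>

subsection \<open>Point sets and intervals\<close>

type_synonym point = "real \<times> real"

definition gen_pos :: "point set \<Rightarrow> bool" where
  "gen_pos S \<longleftrightarrow> finite S \<and> inj_on fst S \<and> inj_on snd S"

definition occurs :: "nat list \<Rightarrow> (nat \<Rightarrow> point) \<Rightarrow> point set \<Rightarrow> bool" where
  "occurs xs f S \<longleftrightarrow> (\<forall>i<length xs. f i \<in> S) \<and>
     (\<forall>i<length xs. \<forall>j<length xs. i < j \<longrightarrow> fst (f i) < fst (f j)) \<and>
     (\<forall>i<length xs. \<forall>j<length xs. xs ! i < xs ! j \<longleftrightarrow> snd (f i) < snd (f j))"

definition NE :: "point set \<Rightarrow> point \<Rightarrow> point set" where
  "NE S p = {q \<in> S. fst p < fst q \<and> snd p < snd q}"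

text \<open>Avoidance of \<open>1 \<oplus> \<rho>\<close>, not of \<open>\<rho>\<close>.\<close>

definition avoids :: "nat list \<Rightarrow> point set \<Rightarrow> bool" where
  "avoids \<rho> S \<longleftrightarrow> (\<forall>p\<in>S. \<nexists>f. occurs \<rho> f (NE S p))"

text \<open>Unlike for \<open>perm_interval\<close>, the empty set and \<open>S\<close> itself
  qualify, as restrictions and intersections of intervals may be either.\<close>

definition interval_in :: "point set \<Rightarrow> point set \<Rightarrow> bool" where
  "interval_in S J \<longleftrightarrow> J \<subseteq> S \<and> (\<forall>p\<in>S - J. \<forall>u\<in>J. \<forall>v\<in>J.
     \<not> (fst u < fst p \<and> fst p < fst v) \<and> \<not> (snd u < snd p \<and> snd p < snd v))"

lemma occurs_mono: "occurs xs f S \<Longrightarrow> S \<subseteq> T \<Longrightarrow> occurs xs f T"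
  by (auto simp: occurs_def)

lemma NE_mono: "S \<subseteq> T \<Longrightarrow> NE S p \<subseteq> NE T p"
  by (auto simp: NE_def)

lemma avoids_subset: "avoids \<rho> T \<Longrightarrow> S \<subseteq> T \<Longrightarrow> avoids \<rho> S"
  unfolding avoids_def by (meson NE_mono occurs_mono subsetD)

lemma gen_pos_subset: "gen_pos T \<Longrightarrow> S \<subseteq> T \<Longrightarrow> gen_pos S"
  unfolding gen_pos_def by (meson finite_subset inj_on_subset)

lemma gen_pos_insert:
  assumes "gen_pos S" "fst p \<notin> fst ` S" "snd p \<notin> snd ` S"
  shows "gen_pos (insert p S)"
  using assms unfolding gen_pos_def by (auto simp: inj_on_insert)

lemma interval_in_restrict: "interval_in T J \<Longrightarrow> S \<subseteq> T \<Longrightarrow> interval_in S (J \<inter> S)"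
  unfolding interval_in_def by blast

lemma interval_in_trans: "interval_in T J \<Longrightarrow> interval_in J K \<Longrightarrow> interval_in T K"
  unfolding interval_in_def by blast

lemma interval_side_fst:
  assumes "gen_pos S" "interval_in S I" "p \<in> S - I"
  shows "(\<forall>u\<in>I. fst p < fst u) \<or> (\<forall>u\<in>I. fst u < fst p)"
proof -
  have "fst u \<noteq> fst p" if "u \<in> I" for u
    using assms that unfolding gen_pos_def interval_in_def inj_on_def by blast
  then show ?thesis using assms unfolding interval_in_def by (meson linorder_neqE_linordered_idom)
qed

lemma interval_side_snd:
  assumes "gen_pos S" "interval_in S I" "p \<in> S - I"
  shows "(\<forall>u\<in>I. snd p < snd u) \<or> (\<forall>u\<in>I. snd u < snd p)"
proof -
  have "snd u \<noteq> snd p" if "u \<in> I" for u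
    using assms that unfolding gen_pos_def interval_in_def inj_on_def by blast
  then show ?thesis using assms unfolding interval_in_def by (meson linorder_neqE_linordered_idom)
qed

lemma interval_same_side:
  assumes "gen_pos S" "interval_in S I" "p \<in> S - I" "u \<in> I" "v \<in> I"
  shows "fst u < fst p \<longleftrightarrow> fst v < fst p" "fst p < fst u \<longleftrightarrow> fst p < fst v"
    and "snd u < snd p \<longleftrightarrow> snd v < snd p" "snd p < snd u \<longleftrightarrow> snd p < snd v"
  using interval_side_fst[OF assms(1-3)] interval_side_snd[OF assms(1-3)] assms(4,5)
  by (meson less_asym)+

section \<open>Coordinates next to a given one, and extremal points of finite sets\<close>

lemma gap_right:
  fixes a :: real assumes "finite A"
  shows "\<exists>x>a. \<forall>z\<in>A. a < z \<longrightarrow> x < z"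
  using assms
proof induction
  case empty
  then show ?case using gt_ex by blast
next
  case (insert b A)
  then obtain x where x: "x > a" "\<forall>z\<in>A. a < z \<longrightarrow> x < z" by blast
  show ?case
  proof (cases "a < b")
    case True
    then obtain c where "a < c" "c < b" using dense by blast
    then show ?thesis using x by (intro exI[of _ "min x c"]) auto
  qed (use x in auto)
qed

lemma gap_left:
  fixes a :: real assumes "finite A"
  shows "\<exists>x<a. \<forall>z\<in>A. z < a \<longrightarrow> z < x"
  using assms
proof induction
  case empty
  then show ?case using lt_ex by blast
next
  case (insert b A)
  then obtain x where x: "x < a" "\<forall>z\<in>A. z < a \<longrightarrow> z < x" by blast
  show ?case
  proof (cases "b < a")
    case True
    then obtain c where "b < c" "c < a" using dense by blast
    then show ?thesis using x by (intro exI[of _ "max x c"]) auto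
  qed (use x in auto)
qed

lemma finite_argmin:
  fixes X :: "'a \<Rightarrow> real" assumes "finite A" "A \<noteq> {}"
  obtains m where "m \<in> A" "\<And>q. q \<in> A \<Longrightarrow> X m \<le> X q"
  using assms by (metis arg_min_if_finite(1) arg_min_least)

lemma finite_argmax:
  fixes X :: "'a \<Rightarrow> real" assumes "finite A" "A \<noteq> {}"
  obtains m where "m \<in> A" "\<And>q. q \<in> A \<Longrightarrow> X q \<le> X m"
  using finite_argmin[OF assms, of "\<lambda>q. - X q"] by auto

subsection \<open>Cutting an interval by a new point\<close>

text \<open>With no point of \<open>S\<close> to its south-west, \<open>p\<close> could only play
  the initial 1 of 1 \<oplus> \<rho>, and the last assumption excludes that.\<close>

lemma avoids_insert_minimum:
  assumes "avoids \<rho> S" "\<And>q. q \<in> S \<Longrightarrow> fst q < fst p \<Longrightarrow> \<not> snd q < snd p"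
    and "\<nexists>f. occurs \<rho> f (NE S p)"
  shows "avoids \<rho> (insert p S)"
proof -
  have "NE (insert p S) q = NE S q" if "q \<in> insert p S" for q
    using assms(2)[of q] that by (auto simp: NE_def)
  then show ?thesis using assms by (auto simp: avoids_def)
qed

text \<open>The old point \<open>q\<close> is essential: absorbing \<open>p\<close> alone would not
  lower the number of points outside the interval spanned by a pair.\<close>

definition cuts :: "point set \<Rightarrow> point set \<Rightarrow> point \<Rightarrow> bool" where
  "cuts S I p \<longleftrightarrow> (\<forall>J. interval_in (insert p S) J \<longrightarrow> I \<subseteq> J \<longrightarrow> p \<in> J \<and> (\<exists>q\<in>S - I. q \<in> J))"

text \<open>The height of \<open>p\<close> lies between those of two points of \<open>I\<close>,
  which forces \<open>p\<close> into \<open>J\<close>; then \<open>q\<close>, horizontally between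
  \<open>p\<close> and \<open>w\<close>, is forced in as well. The next two lemmas exchange the
  axes, with \<open>p\<close> below or above \<open>q\<close>.\<close>

lemma cutsI_horizontal:
  assumes "u \<in> I" "v \<in> I" "snd u < snd p" "snd p < snd v"
    and "q \<in> S - I" "w \<in> I" "fst p < fst q" "fst q < fst w"
  shows "cuts S I p"
  unfolding cuts_def
proof (intro allI impI)
  fix J assume J: "interval_in (insert p S) J" "I \<subseteq> J"
  then have p: "p \<in> J" using assms unfolding interval_in_def by blast
  then have "q \<in> J" using J assms unfolding interval_in_def by blast
  then show "p \<in> J \<and> (\<exists>q\<in>S - I. q \<in> J)" using p assms by blast
qed

lemma cutsI_below:
  assumes "u \<in> I" "v \<in> I" "fst u < fst p" "fst p < fst v"
    and "q \<in> S - I" "w \<in> I" "snd p < snd q" "snd q < snd w"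
  shows "cuts S I p"
  unfolding cuts_def
proof (intro allI impI)
  fix J assume J: "interval_in (insert p S) J" "I \<subseteq> J"
  then have p: "p \<in> J" using assms unfolding interval_in_def by blast
  then have "q \<in> J" using J assms unfolding interval_in_def by blast
  then show "p \<in> J \<and> (\<exists>q\<in>S - I. q \<in> J)" using p assms by blast
qed

lemma cutsI_above:
  assumes "u \<in> I" "v \<in> I" "fst u < fst p" "fst p < fst v"
    and "q \<in> S - I" "w \<in> I" "snd w < snd q" "snd q < snd p"
  shows "cuts S I p"
  unfolding cuts_def
proof (intro allI impI)
  fix J assume J: "interval_in (insert p S) J" "I \<subseteq> J"
  then have p: "p \<in> J" using assms unfolding interval_in_def by blast
  then have "q \<in> J" using J assms unfolding interval_in_def by blast
  then show "p \<in> J \<and> (\<exists>q\<in>S - I. q \<in> J)" using p assms by blast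
qed

lemma cut_southwest:
  assumes S: "gen_pos S" "avoids \<rho> S" and I: "interval_in S I" "u \<in> I" "v \<in> I" "u \<noteq> v"
    and o: "o' \<in> S" "\<forall>w\<in>I. fst o' < fst w \<and> snd o' < snd w"
  shows "\<exists>p. gen_pos (insert p S) \<and> avoids \<rho> (insert p S) \<and> cuts S I p"
proof -
  have fin: "finite S" and IS: "I \<subseteq> S" using S I by (auto simp: gen_pos_def interval_in_def)
  have inj: "\<And>x y. x \<in> S \<Longrightarrow> y \<in> S \<Longrightarrow> fst x = fst y \<Longrightarrow> x = y"
    "\<And>x y. x \<in> S \<Longrightarrow> y \<in> S \<Longrightarrow> snd x = snd y \<Longrightarrow> x = y"
    using S by (auto simp: gen_pos_def inj_on_def)
  have "snd u \<noteq> snd v" using inj I IS by blast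
  then obtain a b where ab: "a \<in> I" "b \<in> I" "snd a < snd b"
    using I by (meson linorder_neqE_linordered_idom)
  define Q where "Q = {q \<in> S. \<forall>w\<in>I. fst q < fst w \<and> snd q < snd w}"
  have "finite Q" "Q \<noteq> {}" using fin o unfolding Q_def by (simp, blast)
  then obtain m where m: "m \<in> Q" and mmin: "\<And>q. q \<in> Q \<Longrightarrow> fst m \<le> fst q"
    by (rule finite_argmin[where X = fst]) blast
  obtain y where y: "snd a < y" "\<forall>z\<in>snd ` S. snd a < z \<longrightarrow> y < z"
    using gap_right[of "snd ` S" "snd a"] fin by blast
  obtain x where x: "x < fst m" "\<forall>z\<in>fst ` S. z < fst m \<longrightarrow> z < x"
    using gap_left[of "fst ` S" "fst m"] fin by blast
  define p where "p = (x, y)"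
  have yb: "y < snd b" using y ab IS by auto
  have mS: "m \<in> S" "m \<notin> I" and mI: "\<And>w. w \<in> I \<Longrightarrow> fst m < fst w \<and> snd m < snd w"
    using m unfolding Q_def by blast+
  have "x \<notin> fst ` S" "y \<notin> snd ` S" using x y by auto
  then have gp: "gen_pos (insert p S)" using S by (simp add: gen_pos_insert p_def)
  \<comment> \<open>A point south-west of \<open>p\<close> would be left of \<open>m\<close> and
    below \<open>b\<close>, hence south-west of all of \<open>I\<close>, against the choice of
    \<open>m\<close>.\<close>
  have SW: "\<not> snd q < snd p" if "q \<in> S" "fst q < fst p" for q
  proof
    assume *: "snd q < snd p"
    have qm: "fst q < fst m" using that x by (simp add: p_def)
    then have qI: "q \<in> S - I" using mI[of q] that by auto
    have "\<forall>w\<in>I. fst q < fst w" using qm mI by fastforce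
    moreover have "\<forall>w\<in>I. snd q < snd w"
      using interval_side_snd[OF S(1) I(1) qI] * yb ab unfolding p_def by force
    ultimately have "q \<in> Q" using that by (auto simp: Q_def)
    then show False using mmin qm by fastforce
  qed
  \<comment> \<open>\<open>p\<close> is higher than \<open>m\<close>, and no point of
    \<open>S\<close> lies horizontally between \<open>p\<close> and \<open>m\<close>.\<close>
  have "NE S p \<subseteq> NE S m"
  proof
    fix q assume "q \<in> NE S p"
    then have q: "q \<in> S" "x < fst q" "y < snd q" by (auto simp: NE_def p_def)
    have "snd m < y" using mI[OF ab(1)] y by simp
    moreover have "fst m \<le> fst q" using x q by (meson imageI not_le order_less_asym)
    moreover have "q \<noteq> m" using q \<open>snd m < y\<close> by auto
    ultimately show "q \<in> NE S m" using q inj(1)[of m q] mS unfolding NE_def by force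
  qed
  then have "\<nexists>f. occurs \<rho> f (NE S p)" using S mS unfolding avoids_def by (meson occurs_mono)
  then have "avoids \<rho> (insert p S)" using avoids_insert_minimum S SW by blast
  moreover have "cuts S I p"
    by (rule cutsI_horizontal[of a I b p m _ a]) (use ab y yb mS mI x in \<open>auto simp: p_def\<close>)
  ultimately show ?thesis using gp by blast
qed

section \<open>Intervals with all outer points to the north-west or south-east\<close>

lemma occurs_card:
  assumes "occurs xs f A" "finite A"
  shows "length xs \<le> card A"
proof -
  have "inj_on f {..<length xs}"
    using assms unfolding occurs_def inj_on_def by (metis lessThan_iff less_irrefl linorder_neqE_nat)
  moreover have "f ` {..<length xs} \<subseteq> A" using assms by (auto simp: occurs_def)
  ultimately show ?thesis using card_inj_on_le[of f "{..<length xs}" A] assms by simp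
qed

text \<open>The coordinate functions are abstract so that the axes can be exchanged. The new point
  goes just left of \<open>q\<close>, the rightmost point north-west of \<open>I\<close>, and just
  below \<open>M\<close>, the highest point of \<open>I\<close>. To its north-east a point of
  \<open>I\<close> can only be \<open>M\<close>, and an outer point, being higher than
  \<open>I\<close>, can only be \<open>q\<close>.\<close>

lemma corner:
  fixes X Y :: "'p \<Rightarrow> real"
  assumes S: "finite S" "inj_on X S" "inj_on Y S" "I \<subseteq> S"
    and uv: "u \<in> I" "v \<in> I" "u \<noteq> v"
    and side: "\<And>q. q \<in> S - I \<Longrightarrow> (\<forall>w\<in>I. X q < X w \<and> Y w < Y q) \<or> (\<forall>w\<in>I. X w < X q \<and> Y q < Y w)"
    and e: "e \<in> S" "\<forall>w\<in>I. X e < X w"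
  obtains x y q M a where "x \<notin> X ` S" "y \<notin> Y ` S" "q \<in> S - I" "x < X q" "X q < X M"
    "M \<in> I" "a \<in> I" "Y a < y" "y < Y M"
    "\<And>r. r \<in> S \<Longrightarrow> x < X r \<Longrightarrow> y < Y r \<Longrightarrow> r \<in> {q, M}"
    "\<And>r. r \<in> S \<Longrightarrow> X r < x \<Longrightarrow> \<not> Y r < y"
proof -
  define L where "L = {q \<in> S. \<forall>w\<in>I. X q < X w}"
  have "finite L" "L \<noteq> {}" using S e by (auto simp: L_def)
  then obtain q where q: "q \<in> L" and qmax: "\<And>r. r \<in> L \<Longrightarrow> X r \<le> X q"
    by (rule finite_argmax[where X = X]) blast
  have "finite I" "I \<noteq> {}" using S uv finite_subset by blast+
  then obtain M where M: "M \<in> I" and Mmax: "\<And>r. r \<in> I \<Longrightarrow> Y r \<le> Y M"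
    by (rule finite_argmax[where X = Y]) blast
  obtain a where a: "a \<in> I" "a \<noteq> M" using uv by metis
  then have aM: "Y a < Y M" using Mmax S M by (meson inj_onD order_le_neq_trans subsetD)
  obtain x where x: "x < X q" "\<forall>z\<in>X ` S. z < X q \<longrightarrow> z < x"
    using gap_left[of "X ` S" "X q"] S by blast
  obtain y where y: "y < Y M" "\<forall>z\<in>Y ` S. z < Y M \<longrightarrow> z < y"
    using gap_left[of "Y ` S" "Y M"] S by blast
  have qI: "q \<in> S - I" "\<And>w. w \<in> I \<Longrightarrow> X q < X w" using q unfolding L_def by blast+
  show ?thesis
  proof (rule that[of x y q M a])
    show "x \<notin> X ` S" "y \<notin> Y ` S" using x y by auto
    show "Y a < y" using y a S aM by blast
    show "r \<in> {q, M}" if r: "r \<in> S" "x < X r" "y < Y r" for r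
    proof (cases "r \<in> I")
      case True
      then have "Y r = Y M" using Mmax y r by force
      then show ?thesis using S True M by (metis inj_onD insertCI subsetD)
    next
      case False
      have "Y M \<le> Y r" using y r by force
      then have "\<forall>w\<in>I. X r < X w" using side[of r] False r M by force
      then have "r \<in> L" using r by (auto simp: L_def)
      then have "X r = X q" using qmax x r by force
      then show ?thesis using S r qI by (metis Diff_iff inj_onD insertCI)
    qed
    \<comment> \<open>Left of \<open>x\<close> means left of \<open>q\<close>, hence left of
      \<open>I\<close>; by \<open>side\<close> such a point is higher than \<open>I\<close>.\<close>
    show "\<not> Y r < y" if r: "r \<in> S" "X r < x" for r
    proof -
      have *: "\<forall>w\<in>I. X r < X w" using r x qI by force
      then have "r \<in> S - I" using r by blast
      then show ?thesis using side[of r] * M y by force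
    qed
  qed (use qI M a x y in auto)
qed

lemma cut_corner:
  assumes S: "gen_pos S" "avoids \<rho> S" "length \<rho> \<ge> 3"
    and I: "interval_in S I" "u \<in> I" "v \<in> I" "u \<noteq> v" "I \<noteq> S"
    and SW: "\<nexists>q. q \<in> S \<and> (\<forall>w\<in>I. fst q < fst w \<and> snd q < snd w)"
    and NE: "\<nexists>q. q \<in> S \<and> (\<forall>w\<in>I. fst w < fst q \<and> snd w < snd q)"
  shows "\<exists>p. gen_pos (insert p S) \<and> avoids \<rho> (insert p S) \<and> cuts S I p"
proof -
  have basic: "finite S" "inj_on fst S" "inj_on snd S" "I \<subseteq> S"
    using S I by (auto simp: gen_pos_def interval_in_def)
  have side: "(\<forall>w\<in>I. fst q < fst w \<and> snd w < snd q) \<or> (\<forall>w\<in>I. fst w < fst q \<and> snd q < snd w)"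
    if "q \<in> S - I" for q
    using interval_side_fst[OF S(1) I(1) that] interval_side_snd[OF S(1) I(1) that] SW NE that
    by blast
  have av: "avoids \<rho> (insert p S)"
    if SWp: "\<And>r. r \<in> S \<Longrightarrow> fst r < fst p \<Longrightarrow> \<not> snd r < snd p" and sub: "NE S p \<subseteq> {q, M}" for p q M
  proof (rule avoids_insert_minimum)
    show "\<nexists>f. occurs \<rho> f (NE S p)"
    proof
      assume "\<exists>f. occurs \<rho> f (NE S p)"
      then obtain f where "occurs \<rho> f {q, M}" using sub occurs_mono by blast
      then have "length \<rho> \<le> card {q, M}" by (rule occurs_card) simp
      also have "\<dots> \<le> 2" by (simp add: card_insert_if)
      finally show False using S by simp
    qed
  qed (use S SWp in auto)
  obtain e where e: "e \<in> S - I" using I by (auto simp: interval_in_def)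
  consider "\<forall>w\<in>I. fst e < fst w" | "\<forall>w\<in>I. snd e < snd w" using side[OF e] by blast
  then show ?thesis
  proof cases
    case 1
    obtain x y q M a where p: "x \<notin> fst ` S" "y \<notin> snd ` S" "q \<in> S - I" "x < fst q" "fst q < fst M"
      "M \<in> I" "a \<in> I" "snd a < y" "y < snd M"
      "\<And>r. r \<in> S \<Longrightarrow> x < fst r \<Longrightarrow> y < snd r \<Longrightarrow> r \<in> {q, M}"
      "\<And>r. r \<in> S \<Longrightarrow> fst r < x \<Longrightarrow> \<not> snd r < y"
      by (rule corner[OF basic I(2,3,4), of e]) (use side e 1 in \<open>blast+\<close>)
    have "NE S (x, y) \<subseteq> {q, M}" using p(10) unfolding NE_def by auto
    then have "avoids \<rho> (insert (x, y) S)" using p(11) by (intro av) auto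
    moreover have "gen_pos (insert (x, y) S)" using S p by (intro gen_pos_insert) auto
    moreover have "cuts S I (x, y)"
      by (rule cutsI_horizontal[of a I M _ q _ M]) (use p in auto)
    ultimately show ?thesis by blast
  next
    case 2
    \<comment> \<open>Here \<open>e\<close> is south-east of \<open>I\<close>. This is the previous
      case reflected in the diagonal, so the coordinates change places.\<close>
    obtain y x q M a where p: "y \<notin> snd ` S" "x \<notin> fst ` S" "q \<in> S - I" "y < snd q" "snd q < snd M"
      "M \<in> I" "a \<in> I" "fst a < x" "x < fst M"
      "\<And>r. r \<in> S \<Longrightarrow> y < snd r \<Longrightarrow> x < fst r \<Longrightarrow> r \<in> {q, M}"
      "\<And>r. r \<in> S \<Longrightarrow> snd r < y \<Longrightarrow> \<not> fst r < x"
      by (rule corner[OF basic(1,3,2,4) I(2,3,4), of e]) (use side e 2 in \<open>blast+\<close>)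
    have "NE S (x, y) \<subseteq> {q, M}" using p(10) unfolding NE_def by auto
    then have "avoids \<rho> (insert (x, y) S)" using p(11) by (intro av) auto
    moreover have "gen_pos (insert (x, y) S)" using S p by (intro gen_pos_insert) auto
    moreover have "cuts S I (x, y)"
      by (rule cutsI_below[of a I M _ q _ M]) (use p in auto)
    ultimately show ?thesis by blast
  qed
qed

section \<open>Intervals with points to the north-east and none to the south-west\<close>

lemma adjacent_pair_bond:
  assumes "is_perm \<rho>" "Suc k < length \<rho>" and occ: "occurs \<rho> f S"
    and adj: "\<And>i. i < length \<rho> \<Longrightarrow> i \<noteq> k \<Longrightarrow> i \<noteq> Suc k \<Longrightarrow> snd (f i) < snd (f k) \<longleftrightarrow> snd (f i) < snd (f (Suc k))"
  shows "snd (f k) < snd (f (Suc k)) \<Longrightarrow> increasing_bond \<rho> k"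
    and "snd (f (Suc k)) < snd (f k) \<Longrightarrow> decreasing_bond \<rho> k"
proof -
  have val: "\<rho> ! i < \<rho> ! j \<longleftrightarrow> snd (f i) < snd (f j)" if "i < length \<rho>" "j < length \<rho>" for i j
    using occ that by (simp add: occurs_def)
  have rng: "\<rho> ! i \<in> {1..length \<rho>}" if "i < length \<rho>" for i
    using assms(1) that nth_mem unfolding is_perm_def by blast
  \<comment> \<open>As \<rho> is a permutation, a value strictly between the two would be one of its
    entries, and its point would separate the two points in height, contrary to
    \<open>adj\<close>.\<close>
  have nob: "\<not> (\<rho> ! i < y \<and> y < \<rho> ! j)"
    if ij: "{i, j} = {k, Suc k}" for i j y
  proof
    assume y: "\<rho> ! i < y \<and> y < \<rho> ! j"
    have ijl: "i < length \<rho>" "j < length \<rho>" using ij assms(2) by (auto simp: doubleton_eq_iff)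
    then have "y \<in> set \<rho>" using y rng[of i] rng[of j] assms(1) by (auto simp: is_perm_def)
    then obtain l where l: "l < length \<rho>" "\<rho> ! l = y" by (metis in_set_conv_nth)
    then have "l \<noteq> k" "l \<noteq> Suc k" using y ij by (auto simp: doubleton_eq_iff)
    then show False using adj[of l] val[of i l] val[of l j] val[of l i] val[of j l] y l ij ijl
      by (auto simp: doubleton_eq_iff)
  qed
  show "increasing_bond \<rho> k" if "snd (f k) < snd (f (Suc k))"
  proof -
    have "\<rho> ! k < \<rho> ! Suc k" using val that assms(2) by simp
    moreover have "\<not> Suc (\<rho> ! k) < \<rho> ! Suc k" using nob[of k "Suc k" "Suc (\<rho> ! k)"] by auto
    ultimately show ?thesis using assms(2) by (auto simp: increasing_bond_def bond_def)
  qed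
  show "decreasing_bond \<rho> k" if "snd (f (Suc k)) < snd (f k)"
  proof -
    have "\<rho> ! Suc k < \<rho> ! k" using val that assms(2) by simp
    moreover have "\<not> Suc (\<rho> ! Suc k) < \<rho> ! k"
      using nob[of "Suc k" k "Suc (\<rho> ! Suc k)"] by (auto simp: insert_commute)
    ultimately show ?thesis using assms(2) by (auto simp: decreasing_bond_def bond_def)
  qed
qed

text \<open>
  The entries \<open>p\<close> and \<open>t\<close> are adjacent in value, and only entries of \<open>I\<close> or below \<open>I\<close> lie
  between them in position.  These take no part in an occurrence of \<open>1 \<oplus> \<rho>\<close> that uses \<open>p\<close>,
  so that \<open>p\<close> and \<open>t\<close> together form a bond of \<open>\<rho>\<close>, while \<open>p\<close> alone could be replaced by \<open>t\<close>.
\<close>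

lemma avoids_insert_above:
  assumes S: "gen_pos S" "avoids \<rho> S" and \<rho>: "is_perm \<rho>" "length \<rho> \<ge> 3" "\<rho> ! 0 < \<rho> ! 1"
    and I: "interval_in S I"
    and SW: "\<nexists>q. q \<in> S \<and> (\<forall>w\<in>I. fst q < fst w \<and> snd q < snd w)"
    and a: "a \<in> I" "\<And>w. w \<in> I \<Longrightarrow> fst a \<le> fst w"
    and v: "v \<in> I" "fst p < fst v"
    and t: "t \<in> S" "\<And>w. w \<in> I \<Longrightarrow> fst w < fst t \<and> snd w < snd t"
    and tmin: "\<And>q. q \<in> S \<Longrightarrow> (\<forall>w\<in>I. fst w < fst q \<and> snd w < snd q) \<Longrightarrow> fst t \<le> fst q"
    and px: "fst a < fst p" "\<And>q. q \<in> S \<Longrightarrow> fst a < fst q \<Longrightarrow> fst p < fst q"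
    and py: "snd p \<notin> snd ` S" "\<And>q. q \<in> S \<Longrightarrow> q \<noteq> t \<Longrightarrow> snd q < snd p \<longleftrightarrow> snd q < snd t"
    and up: "snd p < snd t \<Longrightarrow> \<nexists>i. increasing_bond \<rho> i"
    and down: "snd t < snd p \<Longrightarrow> (\<nexists>i. decreasing_bond \<rho> i) \<or>
        (\<forall>q\<in>S - I. (\<forall>w\<in>I. snd w < snd q) \<longrightarrow> \<not> snd q < snd t)"
  shows "avoids \<rho> (insert p S)"
proof -
  have IS: "I \<subseteq> S" using I by (simp add: interval_in_def)
  have inj: "\<And>x y. x \<in> S \<Longrightarrow> y \<in> S \<Longrightarrow> fst x = fst y \<Longrightarrow> x = y"
    using S by (auto simp: gen_pos_def inj_on_def)
  have Ip: "snd w < snd p" if "w \<in> I" for w using py(2)[of w] t(2)[OF that] that IS by auto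
  have len: "0 < length \<rho>" "1 < length \<rho>" using \<rho>(2) by auto
  have pt: "fst p < fst t" using v t(2)[OF v(1)] by simp
  have False if o: "o' \<in> insert p S" and f: "occurs \<rho> f (NE (insert p S) o')" for o' f
  proof -
    have fin: "f i \<in> S" "fst o' < fst (f i)" "snd o' < snd (f i)" if "i < length \<rho>" "f i \<noteq> p" for i
      using f that by (auto simp: occurs_def NE_def)
    have mono: "fst (f i) < fst (f j)" if "i < j" "j < length \<rho>" for i j
      using f that by (auto simp: occurs_def)
    have val: "\<rho> ! i < \<rho> ! j \<longleftrightarrow> snd (f i) < snd (f j)" if "i < length \<rho>" "j < length \<rho>" for i j
      using f that by (auto simp: occurs_def)
    \<comment> \<open>If \<open>p\<close> played the 1, then \<open>a\<close> could replace it,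
      since \<open>a\<close> is south-west of \<open>p\<close>.\<close>
    have "o' \<noteq> p"
    proof
      assume "o' = p"
      then have "NE (insert p S) o' \<subseteq> NE S a" using px(1) Ip[OF a(1)] by (auto simp: NE_def)
      then show False using f S a IS unfolding avoids_def by (meson occurs_mono subsetD)
    qed
    then have oS: "o' \<in> S" using o by simp
    have "\<exists>k<length \<rho>. f k = p"
    proof (rule ccontr)
      assume "\<not> ?thesis"
      then have "occurs \<rho> f (NE S o')" using f fin unfolding occurs_def NE_def by auto
      then show False using S oS by (auto simp: avoids_def)
    qed
    then obtain k where k: "k < length \<rho>" "f k = p" by blast
    have op: "fst o' < fst p" "snd o' < snd p"
      using f k \<open>o' \<noteq> p\<close> by (auto simp: occurs_def NE_def)
    have oa: "fst o' \<le> fst a" using px(2)[OF oS] op by force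
    \<comment> \<open>The point \<open>o'\<close> is left of \<open>p\<close>, hence not to the
      right of \<open>a\<close>. If it is outside \<open>I\<close>, it is left of \<open>I\<close>,
      and by \<open>SW\<close> it must be above \<open>I\<close>.\<close>
    have ocase: "o' = a \<or> o' \<in> S - I \<and> (\<forall>w\<in>I. fst o' < fst w) \<and> (\<forall>w\<in>I. snd w < snd o')"
    proof (cases "o' \<in> I")
      case True
      then have "fst o' = fst a" using oa a(2)[OF True] by simp
      then show ?thesis using inj oS a IS by blast
    next
      case False
      then have oI: "o' \<in> S - I" using oS by blast
      have l: "\<forall>w\<in>I. fst o' < fst w"
        using interval_side_fst[OF S(1) I oI] oa a(1) by (meson not_less)
      then have "\<forall>w\<in>I. snd w < snd o'"
        using interval_side_snd[OF S(1) I oI] SW oS by blast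
      then show ?thesis using oI l by blast
    qed
    have right_of: "\<forall>w\<in>I. fst w < fst q" if "q \<in> S - I" "fst a < fst q" for q
      using interval_side_fst[OF S(1) I that(1)] that a(1) by (meson less_asym)
    have above: "\<forall>w\<in>I. snd w < snd q" if "q \<in> S - I" "w \<in> I" "snd w < snd q" for q w
      using interval_side_snd[OF S(1) I that(1)] that by (meson less_asym)
    \<comment> \<open>If \<open>o'\<close> is \<open>a\<close>, then \<open>p\<close> is the first
      entry of the copy, no old point being horizontally between \<open>a\<close> and
      \<open>p\<close>. The initial ascent of \<rho> puts \<open>f 1\<close> above \<open>p\<close>,
      hence outside \<open>I\<close> and to its right, and all later entries follow it. If
      \<open>o'\<close> is above \<open>I\<close>, so is the whole copy, and what lies right of
      \<open>p\<close> is then right of \<open>I\<close>.\<close>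
    have later: "f i \<in> S - I \<and> (\<forall>w\<in>I. fst w < fst (f i) \<and> snd w < snd (f i))"
      if i: "k < i" "i < length \<rho>" for i
    proof -
      have pi: "fst p < fst (f i)" using mono[OF i] k by simp
      then have fi: "f i \<in> S" "fst o' < fst (f i)" "snd o' < snd (f i)" using fin i by auto
      show ?thesis using ocase
      proof
        assume oa': "o' = a"
        have "k = 0"
        proof (rule ccontr)
          assume "k \<noteq> 0"
          then have "fst (f 0) < fst p" using mono[of 0 k] k by simp
          moreover have "f 0 \<noteq> p" using calculation by auto
          ultimately show False using fin[OF len(1)] px(2)[of "f 0"] oa' by simp
        qed
        have "snd p < snd (f 1)" "fst p < fst (f 1)"
          using val[OF len] \<rho>(3) len mono[of 0 1] \<open>k = 0\<close> k by auto
        moreover from this have "f 1 \<in> S" using fin[OF len(2)] by auto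
        ultimately have f1: "f 1 \<in> S - I" using Ip[of "f 1"] by auto
        have f1r: "\<forall>w\<in>I. fst w < fst (f 1)"
          using right_of[OF f1] px(1) \<open>fst p < fst (f 1)\<close> by simp
        have "fst (f 1) \<le> fst (f i)" using mono[of 1 i] i \<open>k = 0\<close> by (cases "i = 1") auto
        then have r: "\<forall>w\<in>I. fst w < fst (f i)" using f1r by (meson less_le_trans)
        then have "f i \<in> S - I" using fi by blast
        then show ?thesis using above[of "f i" a] a oa' fi r by blast
      next
        assume o2: "o' \<in> S - I \<and> (\<forall>w\<in>I. fst o' < fst w) \<and> (\<forall>w\<in>I. snd w < snd o')"
        then have ab: "\<forall>w\<in>I. snd w < snd (f i)" using fi by (meson less_trans)
        then have "f i \<in> S - I" using fi by blast
        then show ?thesis using right_of[of "f i"] ab pi px(1) by simp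
      qed
    qed
    have tle: "fst t \<le> fst (f i)" if "k < i" "i < length \<rho>" for i
      using later[OF that] tmin by blast
    show False
    proof (cases "\<exists>l<length \<rho>. f l = t")
      case False
      \<comment> \<open>All other entries of the copy compare with \<open>t\<close> as they do with
        \<open>p\<close>, both in height and horizontally, so replacing \<open>p\<close> by
        \<open>t\<close> yields a copy inside \<open>S\<close>.\<close>
      define g where "g = f(k := t)"
      have adj: "snd q < snd p \<longleftrightarrow> snd q < snd t" "snd p < snd q \<longleftrightarrow> snd t < snd q"
        if "q \<in> S" "q \<noteq> t" for q
        using py that S(1) t(1) unfolding gen_pos_def inj_on_def
        by (metis image_eqI linorder_cases order_less_asym)+
      have "o' \<noteq> t" using op pt by auto
      then have tNE: "t \<in> NE S o'" using op pt adj(1)[of o'] oS t(1) by (auto simp: NE_def)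
      have neq: "f i \<noteq> p" if "i \<noteq> k" "i < length \<rho>" for i
        using mono[of i k] mono[of k i] that k by (metis linorder_neqE_nat less_irrefl)
      have fS: "f i \<in> NE S o'" "f i \<in> S" "f i \<noteq> t" if "i \<noteq> k" "i < length \<rho>" for i
        using fin[of i] neq[of i] that False by (auto simp: NE_def)
      have fl: "fst t < fst (f i)" if "k < i" "i < length \<rho>" for i
        using tle[OF that] fS[of i] that inj[of t "f i"] t(1) by fastforce
      have fe: "fst (f i) < fst t" if "i < k" for i
        using mono[of i k] that k pt by simp
      have "occurs \<rho> g (NE S o')"
        unfolding occurs_def
      proof (intro conjI allI impI)
        fix i assume "i < length \<rho>"
        then show "g i \<in> NE S o'" using fS tNE by (simp add: g_def)
      next
        fix i j assume "i < length \<rho>" "j < length \<rho>" "i < j"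
        then show "fst (g i) < fst (g j)" using mono fl fe by (auto simp: g_def)
      next
        fix i j assume ij: "i < length \<rho>" "j < length \<rho>"
        then show "\<rho> ! i < \<rho> ! j \<longleftrightarrow> snd (g i) < snd (g j)"
          using val[of i j] adj fS k(2) by (cases "i = k"; cases "j = k") (auto simp: g_def)
      qed
      then show False using S oS by (auto simp: avoids_def)
    next
      case True
      then obtain l where l: "l < length \<rho>" "f l = t" by blast
      have kl: "k < l"
      proof (rule ccontr)
        assume "\<not> k < l"
        then have "fst t \<le> fst p" using mono[of l k] l k by (cases "l = k") auto
        then show False using pt by simp
      qed
      \<comment> \<open>An entry between \<open>p\<close> and \<open>t\<close> would be north-east
        of \<open>I\<close> and left of \<open>t\<close>, against the choice of
        \<open>t\<close>.\<close>
      have "l = Suc k"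
      proof (rule ccontr)
        assume "l \<noteq> Suc k"
        then have "Suc k < l" using kl by simp
        then show False using mono[of "Suc k" l] tle[of "Suc k"] l by simp
      qed
      with l have l: "Suc k < length \<rho>" "f (Suc k) = t" by auto
      have adj: "snd (f i) < snd (f k) \<longleftrightarrow> snd (f i) < snd (f (Suc k))"
        if "i < length \<rho>" "i \<noteq> k" "i \<noteq> Suc k" for i
      proof -
        have "f i \<noteq> p" "f i \<noteq> t"
          using mono[of i k] mono[of k i] mono[of i "Suc k"] mono[of "Suc k" i] that k l
          by (metis linorder_neqE_nat less_irrefl)+
        then show ?thesis using fin[of i] that py(2) k l by simp
      qed
      note bonds = adjacent_pair_bond[OF \<rho>(1) l(1) f adj]
      have "snd p \<noteq> snd t" using py(1) t(1) by blast
      then consider "snd p < snd t" | "snd t < snd p" by linarith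
      then show False
      proof cases
        case 1
        then show False using bonds(1) up k l by simp
      next
        case 2
        \<comment> \<open>The decreasing bond leaves only the second alternative of
          \<open>down\<close>: no outer point has its height between \<open>I\<close> and
          \<open>t\<close>. So \<open>o'\<close>, being below \<open>t\<close>, is \<open>a\<close>;
          hence \<open>p\<close> and \<open>t\<close> are the first two entries, and \<rho> would
          start with a descent.\<close>
        then have nolow: "\<forall>q\<in>S - I. (\<forall>w\<in>I. snd w < snd q) \<longrightarrow> \<not> snd q < snd t"
          using bonds(2) down k l by auto
        have "o' \<noteq> t" using op pt by auto
        then have "snd o' < snd t" using op py(2) oS by simp
        then have "o' = a" using ocase nolow by blast
        have "k = 0"
        proof (rule ccontr)
          assume "k \<noteq> 0"
          then have "fst (f 0) < fst p" using mono[of 0 k] k by simp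
          moreover have "f 0 \<noteq> p" using calculation by auto
          ultimately show False using fin[OF len(1)] px(2)[of "f 0"] \<open>o' = a\<close> by simp
        qed
        then show False using val[OF len] \<rho>(3) 2 k l by simp
      qed
    qed
  qed
  then show ?thesis unfolding avoids_def by blast
qed

lemma cut_northeast:
  assumes S: "gen_pos S" "avoids \<rho> S" and \<rho>: "is_perm \<rho>" "length \<rho> \<ge> 3" "\<rho> ! 0 < \<rho> ! 1"
    "(\<nexists>i. increasing_bond \<rho> i) \<or> (\<nexists>i. decreasing_bond \<rho> i)"
    and I: "interval_in S I" "u \<in> I" "v \<in> I" "u \<noteq> v"
    and SW: "\<nexists>q. q \<in> S \<and> (\<forall>w\<in>I. fst q < fst w \<and> snd q < snd w)"
    and NE: "r \<in> S" "\<forall>w\<in>I. fst w < fst r \<and> snd w < snd r"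
  shows "\<exists>p. gen_pos (insert p S) \<and> avoids \<rho> (insert p S) \<and> cuts S I p"
proof -
  have fin: "finite S" and IS: "I \<subseteq> S" using S I by (auto simp: gen_pos_def interval_in_def)
  have injf: "x = y" if "x \<in> S" "y \<in> S" "fst x = fst y" for x y
    using S that by (auto simp: gen_pos_def inj_on_def)
  have injs: "x = y" if "x \<in> S" "y \<in> S" "snd x = snd y" for x y
    using S that by (auto simp: gen_pos_def inj_on_def)
  define R where "R = {q \<in> S. \<forall>w\<in>I. fst w < fst q \<and> snd w < snd q}"
  have "finite R" "R \<noteq> {}" using fin NE unfolding R_def by (simp, blast)
  then obtain t where t: "t \<in> R" and tmin: "\<And>q. q \<in> R \<Longrightarrow> fst t \<le> fst q"
    by (rule finite_argmin[where X = fst]) blast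
  have "finite I" "I \<noteq> {}" using fin I IS finite_subset by blast+
  then obtain a where a: "a \<in> I" and amin: "\<And>q. q \<in> I \<Longrightarrow> fst a \<le> fst q"
    by (rule finite_argmin[where X = fst]) blast
  obtain b where b: "b \<in> I" "b \<noteq> a" using I by metis
  have ab: "fst a < fst b" using amin[OF b(1)] injf a b IS by (metis order_le_less subsetD)
  obtain x where x: "x > fst a" "\<forall>z\<in>fst ` S. fst a < z \<longrightarrow> x < z"
    using gap_right[of "fst ` S" "fst a"] fin by blast
  have xb: "x < fst b" using x ab b IS by auto
  have tS: "t \<in> S" "t \<in> S - I" and tI: "\<And>w. w \<in> I \<Longrightarrow> fst w < fst t \<and> snd w < snd t"
    using t unfolding R_def by blast+
  have xS: "x \<notin> fst ` S" using x by auto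
  \<comment> \<open>This says that a point just below \<open>t\<close> is still separated from
    \<open>I\<close> in height.\<close>
  define low where "low \<longleftrightarrow> (\<exists>q\<in>S - I. (\<forall>w\<in>I. snd w < snd q) \<and> snd q < snd t)"
  have av: "avoids \<rho> (insert (x, y) S)"
    if "y \<notin> snd ` S" "\<And>q. q \<in> S \<Longrightarrow> q \<noteq> t \<Longrightarrow> snd q < y \<longleftrightarrow> snd q < snd t"
      "y < snd t \<Longrightarrow> \<nexists>i. increasing_bond \<rho> i" "snd t < y \<Longrightarrow> (\<nexists>i. decreasing_bond \<rho> i) \<or> \<not> low" for y
  proof (rule avoids_insert_above[OF S \<rho>(1-3) I(1) SW a amin b(1) _ tS(1) tI])
    show "fst t \<le> fst q" if "q \<in> S" "\<forall>w\<in>I. fst w < fst q \<and> snd w < snd q" for q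
      using that by (intro tmin) (simp add: R_def)
  qed (use that x xb in \<open>auto simp: low_def\<close>)
  show ?thesis
  proof (cases "low \<and> (\<nexists>i. increasing_bond \<rho> i)")
    case True
    then obtain q where q: "q \<in> S - I" "\<forall>w\<in>I. snd w < snd q" "snd q < snd t"
      unfolding low_def by blast
    obtain y where y: "y < snd t" "\<forall>z\<in>snd ` S. z < snd t \<longrightarrow> z < y"
      using gap_left[of "snd ` S" "snd t"] fin by blast
    have yS: "y \<notin> snd ` S" using y by auto
    have "avoids \<rho> (insert (x, y) S)" using y yS True by (intro av) auto
    moreover have "gen_pos (insert (x, y) S)" using S xS yS by (intro gen_pos_insert) auto
    moreover have "cuts S I (x, y)"
      by (rule cutsI_above[of a I b _ q _ a]) (use a b x xb q y in auto)
    ultimately show ?thesis by blast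
  next
    case False
    \<comment> \<open>Either \<open>low\<close> fails, or \<rho> has an increasing bond and
      therefore no decreasing one. In both cases the height just above \<open>t\<close> is safe, and
      \<open>t\<close> itself separates the new point from \<open>I\<close>.\<close>
    obtain y where y: "y > snd t" "\<forall>z\<in>snd ` S. snd t < z \<longrightarrow> y < z"
      using gap_right[of "snd ` S" "snd t"] fin by blast
    have yS: "y \<notin> snd ` S" using y by auto
    have "avoids \<rho> (insert (x, y) S)"
    proof (rule av)
      fix q assume q: "q \<in> S" "q \<noteq> t"
      then have "snd q \<noteq> snd t" using injs tS by blast
      then show "snd q < y \<longleftrightarrow> snd q < snd t" using y q by force
    qed (use y yS False \<rho>(4) in auto)
    moreover have "gen_pos (insert (x, y) S)" using S xS yS by (intro gen_pos_insert) auto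
    moreover have "cuts S I (x, y)"
      by (rule cutsI_above[of a I b _ t _ a]) (use a b x xb tS tI y in auto)
    ultimately show ?thesis by blast
  qed
qed

lemma cut_interval:
  assumes S: "gen_pos S" "avoids \<rho> S" and \<rho>: "is_perm \<rho>" "length \<rho> \<ge> 3" "\<rho> ! 0 < \<rho> ! 1"
    "(\<nexists>i. increasing_bond \<rho> i) \<or> (\<nexists>i. decreasing_bond \<rho> i)"
    and I: "interval_in S I" "u \<in> I" "v \<in> I" "u \<noteq> v" "I \<noteq> S"
  shows "\<exists>p. gen_pos (insert p S) \<and> avoids \<rho> (insert p S) \<and> cuts S I p"
  using cut_southwest[OF S I(1-4)] cut_northeast[OF S \<rho> I(1-4)] cut_corner[OF S \<rho>(2) I]
  by blast

subsection \<open>Simple extensions of point sets\<close>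

definition int_hull :: "point set \<Rightarrow> point \<Rightarrow> point \<Rightarrow> point set" where
  "int_hull S a b = S \<inter> \<Inter>{J. interval_in S J \<and> a \<in> J \<and> b \<in> J}"

text \<open>A point outside an intersection of intervals is outside one of them, and so cannot
  separate two points of the intersection.\<close>

lemma interval_in_int_hull: "interval_in S (int_hull S a b)"
  unfolding interval_in_def int_hull_def by blast

lemma int_hull_least: "interval_in S J \<Longrightarrow> a \<in> J \<Longrightarrow> b \<in> J \<Longrightarrow> int_hull S a b \<subseteq> J"
  unfolding int_hull_def by blast

lemma in_int_hull: "a \<in> S \<Longrightarrow> b \<in> S \<Longrightarrow> a \<in> int_hull S a b \<and> b \<in> int_hull S a b"
  unfolding int_hull_def by blast

text \<open>Induction on the number of points outside the hull of \<open>a\<close> and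
  \<open>b\<close>. Each cut brings into the hull the new point and at least one old point.\<close>

lemma extend_pair:
  assumes \<rho>: "is_perm \<rho>" "length \<rho> \<ge> 3" "\<rho> ! 0 < \<rho> ! 1"
    "(\<nexists>i. increasing_bond \<rho> i) \<or> (\<nexists>i. decreasing_bond \<rho> i)"
    and "gen_pos S" "avoids \<rho> S" "a \<in> S" "b \<in> S" "a \<noteq> b"
  shows "\<exists>T. S \<subseteq> T \<and> gen_pos T \<and> avoids \<rho> T \<and> int_hull T a b = T"
  using assms(5-)
proof (induction "card (S - int_hull S a b)" arbitrary: S rule: less_induct)
  case less
  let ?I = "int_hull S a b"
  show ?case
  proof (cases "?I = S")
    case False
    have ab: "a \<in> ?I" "b \<in> ?I" using in_int_hull less.prems by blast+
    obtain p where p: "gen_pos (insert p S)" "avoids \<rho> (insert p S)" "cuts S ?I p"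
      using cut_interval[OF less.prems(1,2) \<rho> interval_in_int_hull ab] less.prems(5) False by blast
    let ?J = "int_hull (insert p S) a b"
    \<comment> \<open>The hull loses no old point: the trace of the new hull on \<open>S\<close> is
      an interval containing \<open>a\<close> and \<open>b\<close>.\<close>
    have "?J \<inter> S \<supseteq> ?I"
      using int_hull_least interval_in_restrict[OF interval_in_int_hull] in_int_hull less.prems
      by (metis Int_iff insertCI subset_insertI)
    then obtain q where q: "p \<in> ?J" "q \<in> S - ?I" "q \<in> ?J"
      using p(3) interval_in_int_hull unfolding cuts_def by (meson Int_subset_iff)
    have "insert p S - ?J \<subset> S - ?I" using q \<open>?J \<inter> S \<supseteq> ?I\<close> by blast
    then have "card (insert p S - ?J) < card (S - ?I)"
      using less.prems by (intro psubset_card_mono) (auto simp: gen_pos_def)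
    from less.hyps[OF this p(1,2)] less.prems show ?thesis by blast
  qed (use less.prems in blast)
qed

text \<open>The pairs are treated one after the other. Demanding only that \<open>J\<close> contains
  the fixed set \<open>S\<close>, and not the growing \<open>T\<close>, makes the property survive
  later extensions, because intervals restrict to intervals.\<close>

lemma extend_pairs:
  assumes \<rho>: "is_perm \<rho>" "length \<rho> \<ge> 3" "\<rho> ! 0 < \<rho> ! 1"
    "(\<nexists>i. increasing_bond \<rho> i) \<or> (\<nexists>i. decreasing_bond \<rho> i)"
    and S: "gen_pos S" "avoids \<rho> S" and "finite P" "P \<subseteq> S \<times> S"
  shows "\<exists>T. S \<subseteq> T \<and> gen_pos T \<and> avoids \<rho> T \<and>
    (\<forall>(a, b)\<in>P. a \<noteq> b \<longrightarrow> (\<forall>J. interval_in T J \<and> a \<in> J \<and> b \<in> J \<longrightarrow> S \<subseteq> J))"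
  using assms(7,8)
proof induction
  case empty
  then show ?case using S by blast
next
  case (insert c P)
  obtain a b where c: "c = (a, b)" by (cases c)
  obtain T where T: "S \<subseteq> T" "gen_pos T" "avoids \<rho> T"
    "\<forall>(a, b)\<in>P. a \<noteq> b \<longrightarrow> (\<forall>J. interval_in T J \<and> a \<in> J \<and> b \<in> J \<longrightarrow> S \<subseteq> J)"
    using insert by blast
  have ab: "a \<in> T" "b \<in> T" using insert.prems T c by auto
  show ?case
  proof (cases "a = b")
    case True
    then show ?thesis using T c by (intro exI[of _ T]) auto
  next
    case False
    obtain T' where T': "T \<subseteq> T'" "gen_pos T'" "avoids \<rho> T'" "int_hull T' a b = T'"
      using extend_pair[OF \<rho> T(2,3) ab False] by blast
    have "S \<subseteq> J" if J: "interval_in T' J" "a' \<in> J" "b' \<in> J" "(a', b') \<in> insert c P" "a' \<noteq> b'" for a' b' J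
    proof (cases "(a', b') = (a, b)")
      case True
      then show ?thesis using int_hull_least[OF J(1)] J T'(1,4) T(1) by blast
    next
      case False
      then have P': "(a', b') \<in> P" using J c by blast
      then have "a' \<in> T" "b' \<in> T" using insert.prems T(1) by auto
      then have "interval_in T (J \<inter> T)" "a' \<in> J \<inter> T" "b' \<in> J \<inter> T"
        using interval_in_restrict[OF J(1) T'(1)] J by blast+
      then have "S \<subseteq> J \<inter> T" using bspec[OF T(4) P'] J(5) by blast
      then show ?thesis by blast
    qed
    then have "\<forall>(a, b)\<in>insert c P. a \<noteq> b \<longrightarrow> (\<forall>J. interval_in T' J \<and> a \<in> J \<and> b \<in> J \<longrightarrow> S \<subseteq> J)"
      by fast
    then show ?thesis using T(1) T'(1-3) by (meson subset_trans)
  qed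
qed

lemma simple_extension:
  assumes \<rho>: "is_perm \<rho>" "length \<rho> \<ge> 3" "\<rho> ! 0 < \<rho> ! 1"
    "(\<nexists>i. increasing_bond \<rho> i) \<or> (\<nexists>i. decreasing_bond \<rho> i)"
    and S: "gen_pos S" "avoids \<rho> S"
  shows "\<exists>T. S \<subseteq> T \<and> gen_pos T \<and> avoids \<rho> T \<and> (\<forall>J. interval_in T J \<longrightarrow> J \<noteq> T \<longrightarrow> card J \<le> 1)"
proof -
  define good where "good T \<longleftrightarrow> S \<subseteq> T \<and> gen_pos T \<and> avoids \<rho> T \<and>
    (\<forall>a\<in>S. \<forall>b\<in>S. a \<noteq> b \<longrightarrow> (\<forall>J. interval_in T J \<and> a \<in> J \<and> b \<in> J \<longrightarrow> S \<subseteq> J))" for T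
  have "finite (S \<times> S)" using S by (simp add: gen_pos_def)
  then obtain U where U: "S \<subseteq> U" "gen_pos U" "avoids \<rho> U"
    "\<forall>(a, b)\<in>S \<times> S. a \<noteq> b \<longrightarrow> (\<forall>J. interval_in U J \<and> a \<in> J \<and> b \<in> J \<longrightarrow> S \<subseteq> J)"
    using extend_pairs[OF \<rho> S _ subset_refl] by blast
  have "good U"
    unfolding good_def
  proof (intro conjI ballI impI allI)
    fix a b J assume "a \<in> S" "b \<in> S" "a \<noteq> b" "interval_in U J \<and> a \<in> J \<and> b \<in> J"
    then show "S \<subseteq> J" using bspec[OF U(4), of "(a, b)"] by blast
  qed (use U in auto)
  then obtain T where T: "good T" and Tmin: "\<And>U. good U \<Longrightarrow> card T \<le> card U"
    using ex_has_least_nat[of good _ card] by blast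
  have small: False if "good U" "U \<subset> T" for U
  proof -
    have "card U < card T" using that T by (intro psubset_card_mono) (auto simp: good_def gen_pos_def)
    then show False using Tmin[OF that(1)] by simp
  qed
  have "card J \<le> 1" if J: "interval_in T J" "J \<noteq> T" for J
  proof (rule ccontr)
    assume "\<not> card J \<le> 1"
    then have card: "1 < card J" by simp
    have JT: "J \<subset> T" using J by (auto simp: interval_in_def)
    show False
    proof (cases "S \<subseteq> J")
      case True
      \<comment> \<open>Intervals of the interval \<open>J\<close> are intervals of
        \<open>T\<close>, so \<open>J\<close> inherits the property.\<close>
      have "good J"
        using T True JT interval_in_trans[OF J(1)] unfolding good_def
        by (meson avoids_subset gen_pos_subset psubset_imp_subset)
      then show False using small JT by blast
    next
      case False
      then have one: "a = b" if "a \<in> S \<inter> J" "b \<in> S \<inter> J" for a b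
        using T J(1) that unfolding good_def by blast
      have "J \<noteq> {}" using card by auto
      then obtain j where j: "j \<in> J" "S \<inter> J \<subseteq> {j}" using one by blast
      define U where "U = T - (J - {j})"
      have "J - {j} \<noteq> {}" using card j(1) by (cases "J = {j}") auto
      then have UT: "U \<subset> T" using JT unfolding U_def by blast
      have "S \<subseteq> U" using T j unfolding good_def U_def by blast
      have "S \<subseteq> K" if K: "interval_in U K" "a \<in> K" "b \<in> K" "a \<in> S" "b \<in> S" "a \<noteq> b" for K a b
      proof -
        \<comment> \<open>An interval \<open>K\<close> of the contracted set is turned back into an
          interval of \<open>T\<close> by inflating \<open>j\<close> to \<open>J\<close>.\<close>
        define K' where "K' = (if j \<in> K then K \<union> J else K)"
        have gT: "gen_pos T" using T by (simp add: good_def)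
        have KU: "K \<subseteq> U" using K by (simp add: interval_in_def)
        have "interval_in T K'"
        proof (cases "j \<in> K")
          case True
          have out: "p \<in> U - K" "p \<in> T - J" if "p \<in> T - (K \<union> J)" for p
            using that unfolding U_def by blast+
          \<comment> \<open>Seen from a point outside \<open>J\<close>, every point of
            \<open>J\<close> lies on the same sides as \<open>j\<close>, and \<open>j\<close> is in
            \<open>K\<close>.\<close>
          have rep: "\<exists>w\<in>K. (fst w < fst p \<longleftrightarrow> fst z < fst p) \<and> (fst p < fst w \<longleftrightarrow> fst p < fst z) \<and>
              (snd w < snd p \<longleftrightarrow> snd z < snd p) \<and> (snd p < snd w \<longleftrightarrow> snd p < snd z)"
            if "z \<in> K \<union> J" "p \<in> T - (K \<union> J)" for z p
          proof (cases "z \<in> K")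
            case False
            then have "z \<in> J" using that by blast
            then show ?thesis
              using interval_same_side[OF gT J(1) out(2)[OF that(2)] j(1)] True by blast
          qed blast
          have "K \<union> J \<subseteq> T" using KU JT unfolding U_def by blast
          moreover have "\<not> (fst u < fst p \<and> fst p < fst v) \<and> \<not> (snd u < snd p \<and> snd p < snd v)"
            if "p \<in> T - (K \<union> J)" "u \<in> K \<union> J" "v \<in> K \<union> J" for p u v
            using rep[OF that(2,1)] rep[OF that(3,1)] out(1)[OF that(1)] K(1)
            unfolding interval_in_def by meson
          ultimately show ?thesis using True unfolding K'_def interval_in_def by simp
        next
          case False
          then have KJ: "K \<inter> J = {}" using KU unfolding U_def by blast
          have jU: "j \<in> U - K" using False j(1) JT unfolding U_def by blast
          have "\<not> (fst u < fst p \<and> fst p < fst v) \<and> \<not> (snd u < snd p \<and> snd p < snd v)"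
            if p: "p \<in> T - K" and u: "u \<in> K" and v: "v \<in> K" for p u v
          proof (cases "p \<in> J")
            case True
            have uJ: "u \<in> T - J" "v \<in> T - J" using u v KJ KU UT by blast+
            have "\<not> (fst u < fst j \<and> fst j < fst v) \<and> \<not> (snd u < snd j \<and> snd j < snd v)"
              using K(1) jU u v unfolding interval_in_def by blast
            \<comment> \<open>The point \<open>p\<close> of \<open>J\<close> lies on the same sides
              of \<open>u\<close> and \<open>v\<close> as \<open>j\<close>, which is in
              \<open>U\<close> and does not separate them.\<close>
            moreover have "fst u < fst j \<longleftrightarrow> fst u < fst p" "snd u < snd j \<longleftrightarrow> snd u < snd p"
              "fst j < fst v \<longleftrightarrow> fst p < fst v" "snd j < snd v \<longleftrightarrow> snd p < snd v"
              using interval_same_side[OF gT J(1) uJ(1) j(1) True]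
                interval_same_side[OF gT J(1) uJ(2) j(1) True] by blast+
            ultimately show ?thesis by simp
          next
            case False
            then have "p \<in> U - K" using p unfolding U_def by blast
            then show ?thesis using K(1) u v unfolding interval_in_def by blast
          qed
          then show ?thesis using False KU UT unfolding K'_def interval_in_def by auto
        qed
        moreover have "a \<in> K'" "b \<in> K'" using K unfolding K'_def by auto
        ultimately have "S \<subseteq> K'" using T K unfolding good_def by blast
        \<comment> \<open>Inflation adds no point of \<open>S\<close>, since the only point of
          \<open>S\<close> that \<open>J\<close> may contain is \<open>j\<close>.\<close>
        then show ?thesis using j(2) unfolding K'_def by (auto split: if_splits)
      qed
      then have "good U"
        using T \<open>S \<subseteq> U\<close> UT unfolding good_def
        by (meson avoids_subset gen_pos_subset psubset_imp_subset)
      then show False using small UT by blast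
    qed
  qed
  then show ?thesis using T unfolding good_def by blast
qed

subsection \<open>Permutations as point sets\<close>

lemma subseq_indices:
  assumes "subseq s \<beta>"
  shows "\<exists>g. (\<forall>i<length s. g i < length \<beta> \<and> s ! i = \<beta> ! g i) \<and>
    (\<forall>i<length s. \<forall>j<length s. i < j \<longrightarrow> g i < g j)"
  using assms
proof induction
  case (list_emb_Nil ys)
  then show ?case by simp
next
  case (list_emb_Cons xs ys y)
  then obtain g where "(\<forall>i<length xs. g i < length ys \<and> xs ! i = ys ! g i) \<and>
    (\<forall>i<length xs. \<forall>j<length xs. i < j \<longrightarrow> g i < g j)" by blast
  then show ?case by (intro exI[of _ "Suc \<circ> g"]) simp
next
  case (list_emb_Cons2 x y xs ys)
  then obtain g where "(\<forall>i<length xs. g i < length ys \<and> xs ! i = ys ! g i) \<and>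
    (\<forall>i<length xs. \<forall>j<length xs. i < j \<longrightarrow> g i < g j)" by blast
  \<comment> \<open>The matched head gets index 0, and the indices of the tail shift by one.\<close>
  then show ?case using list_emb_Cons2(1)
    by (intro exI[of _ "case_nat 0 (Suc \<circ> g)"]) (auto split: nat.splits simp: nth_Cons)
qed

lemma indices_subseq:
  assumes "\<forall>i<length s. g i < length \<beta> \<and> s ! i = \<beta> ! g i"
    and "\<forall>i<length s. \<forall>j<length s. i < j \<longrightarrow> g i < g j"
  shows "subseq s \<beta>"
  using assms
proof (induction \<beta> arbitrary: s g)
  case Nil
  then show ?case by (cases s) auto
next
  case (Cons b \<beta>)
  show ?case
  proof (cases s)
    case s: (Cons x s')
    show ?thesis
    proof (cases "g 0")
      case 0
      \<comment> \<open>Positivity makes the truncated subtraction exact when the indices are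
        shifted down.\<close>
      have pos: "0 < g (Suc i)" if "i < length s'" for i
        using Cons.prems(2)[rule_format, of 0 "Suc i"] that s by simp
      have "subseq s' \<beta>"
      proof (rule Cons.IH[of _ "\<lambda>i. g (Suc i) - 1"]; intro allI impI)
        fix i assume "i < length s'"
        then show "g (Suc i) - 1 < length \<beta> \<and> s' ! i = \<beta> ! (g (Suc i) - 1)"
          using Cons.prems(1)[rule_format, of "Suc i"] pos[of i] s
          by (cases "g (Suc i)") auto
      next
        fix i j assume "i < length s'" "j < length s'" "i < j"
        then show "g (Suc i) - 1 < g (Suc j) - 1"
          using Cons.prems(2)[rule_format, of "Suc i" "Suc j"] pos[of i] s by simp
      qed
      moreover have "x = b" using Cons.prems(1)[rule_format, of 0] 0 s by simp
      ultimately show ?thesis using s by simp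
    next
      case (Suc m)
      have pos: "0 < g i" if "i < length s" for i
        using Cons.prems(2)[rule_format, of 0 i] that s Suc by (cases "i = 0") auto
      have "subseq s \<beta>"
      proof (rule Cons.IH[of _ "\<lambda>i. g i - 1"]; intro allI impI)
        fix i assume "i < length s"
        then show "g i - 1 < length \<beta> \<and> s ! i = \<beta> ! (g i - 1)"
          using Cons.prems(1)[rule_format, of i] pos[of i] by (cases "g i") auto
      next
        fix i j assume "i < length s" "j < length s" "i < j"
        then show "g i - 1 < g j - 1"
          using Cons.prems(2)[rule_format, of i j] pos[of i] by simp
      qed
      then show ?thesis by (rule list_emb_Cons)
    qed
  qed simp
qed

lemma contained_in_iff_indices:
  "contained_in \<alpha> \<beta> \<longleftrightarrow> (\<exists>g. (\<forall>i<length \<alpha>. g i < length \<beta>) \<and>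
    (\<forall>i<length \<alpha>. \<forall>j<length \<alpha>. i < j \<longrightarrow> g i < g j) \<and>
    (\<forall>i<length \<alpha>. \<forall>j<length \<alpha>. \<alpha> ! i < \<alpha> ! j \<longleftrightarrow> \<beta> ! g i < \<beta> ! g j))" (is "_ \<longleftrightarrow> (\<exists>g. ?P g)")
proof
  assume "contained_in \<alpha> \<beta>"
  then obtain s where s: "subseq s \<beta>" "order_iso \<alpha> s" by (auto simp: contained_in_def)
  obtain g where g: "\<forall>i<length s. g i < length \<beta> \<and> s ! i = \<beta> ! g i"
    "\<forall>i<length s. \<forall>j<length s. i < j \<longrightarrow> g i < g j"
    using subseq_indices[OF s(1)] by blast
  then have "?P g" using s(2) by (simp add: order_iso_def)
  then show "\<exists>g. ?P g" by blast
next
  assume "\<exists>g. ?P g"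
  then obtain g where g: "?P g" by blast
  define s where "s = map (\<lambda>i. \<beta> ! g i) [0..<length \<alpha>]"
  have "subseq s \<beta>" using g by (intro indices_subseq[of s g]) (auto simp: s_def)
  moreover have "order_iso \<alpha> s" using g by (auto simp: order_iso_def s_def)
  ultimately show "contained_in \<alpha> \<beta>" by (auto simp: contained_in_def)
qed

section \<open>Translation between permutations and the point sets whose pattern they are\<close>

definition represents :: "nat list \<Rightarrow> (nat \<Rightarrow> point) \<Rightarrow> point set \<Rightarrow> bool" where
  "represents \<tau> f T \<longleftrightarrow> occurs \<tau> f T \<and> T = f ` {..<length \<tau>}"

text \<open>As \<open>f\<close> lists \<open>T\<close> from left to right, increasing index maps
  into \<tau> and left-to-right choices of points of \<open>T\<close> determine each other.\<close>

lemma contained_in_iff_occurs: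
  assumes "represents \<tau> f T"
  shows "contained_in \<alpha> \<tau> \<longleftrightarrow> (\<exists>h. occurs \<alpha> h T)"
proof
  assume "contained_in \<alpha> \<tau>"
  then obtain g where g: "\<forall>i<length \<alpha>. g i < length \<tau>"
    "\<forall>i<length \<alpha>. \<forall>j<length \<alpha>. i < j \<longrightarrow> g i < g j"
    "\<forall>i<length \<alpha>. \<forall>j<length \<alpha>. \<alpha> ! i < \<alpha> ! j \<longleftrightarrow> \<tau> ! g i < \<tau> ! g j"
    unfolding contained_in_iff_indices by blast
  have "occurs \<alpha> (f \<circ> g) T" using g assms by (auto simp: occurs_def represents_def)
  then show "\<exists>h. occurs \<alpha> h T" by blast
next
  assume "\<exists>h. occurs \<alpha> h T"
  then obtain h where h: "occurs \<alpha> h T" by blast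
  then have "\<forall>i. \<exists>k. i < length \<alpha> \<longrightarrow> k < length \<tau> \<and> f k = h i"
    using assms unfolding occurs_def represents_def by (metis image_iff lessThan_iff)
  then obtain g where g: "\<And>i. i < length \<alpha> \<Longrightarrow> g i < length \<tau>" "\<And>i. i < length \<alpha> \<Longrightarrow> f (g i) = h i"
    by metis
  have "g i < g j" if "i < length \<alpha>" "j < length \<alpha>" "i < j" for i j
  proof (rule ccontr)
    assume "\<not> g i < g j"
    then have "fst (h j) \<le> fst (h i)"
      using assms g(1)[OF that(1)] g(1)[OF that(2)] g(2)[OF that(1)] g(2)[OF that(2)]
      unfolding represents_def occurs_def by (metis linorder_neqE_nat order_le_less)
    moreover have "fst (h i) < fst (h j)" using h that by (auto simp: occurs_def)
    ultimately show False by simp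
  qed
  moreover have "\<alpha> ! i < \<alpha> ! j \<longleftrightarrow> \<tau> ! g i < \<tau> ! g j" if "i < length \<alpha>" "j < length \<alpha>" for i j
    using h assms that g by (simp add: occurs_def represents_def)
  ultimately show "contained_in \<alpha> \<tau>" unfolding contained_in_iff_indices using g(1) by blast
qed

text \<open>The first point of a copy of 1 \<oplus> \<rho> has the others, a copy of \<rho>, to its
  north-east. Entries of \<rho> are positive, so they exceed the leading 1 after the shift by
  \<open>Suc\<close>.\<close>

lemma occurs_perm_sum_iff:
  assumes "is_perm \<rho>"
  shows "(\<exists>h. occurs (perm_sum [1] \<rho>) h T) \<longleftrightarrow> \<not> avoids \<rho> T"
proof -
  have pi: "perm_sum [1] \<rho> = 1 # map Suc \<rho>" by (simp add: perm_sum_def)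
  have pos: "0 < \<rho> ! i" if "i < length \<rho>" for i
  proof -
    have "\<rho> ! i \<in> {1..length \<rho>}" using assms nth_mem[OF that] by (simp only: is_perm_def)
    then show ?thesis by simp
  qed
  show ?thesis
  proof
    assume "\<exists>h. occurs (perm_sum [1] \<rho>) h T"
    then obtain h where h: "occurs (1 # map Suc \<rho>) h T" using pi by auto
    have val: "(1 # map Suc \<rho>) ! i < (1 # map Suc \<rho>) ! j \<longleftrightarrow> snd (h i) < snd (h j)"
      if "i \<le> length \<rho>" "j \<le> length \<rho>" for i j
      using h that by (simp add: occurs_def)
    have mono: "fst (h i) < fst (h j)" if "i < j" "j \<le> length \<rho>" for i j
      using h that by (simp add: occurs_def)
    have mem: "h i \<in> T" if "i \<le> length \<rho>" for i using h that by (simp add: occurs_def)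
    have "occurs \<rho> (h \<circ> Suc) (NE T (h 0))"
      unfolding occurs_def
    proof (intro conjI allI impI)
      fix i assume i: "i < length \<rho>"
      then show "(h \<circ> Suc) i \<in> NE T (h 0)"
        using val[of 0 "Suc i"] mono[of 0 "Suc i"] mem[of "Suc i"] pos[OF i] by (simp add: NE_def)
    next
      fix i j assume "i < length \<rho>" "j < length \<rho>"
      then show "\<rho> ! i < \<rho> ! j \<longleftrightarrow> snd ((h \<circ> Suc) i) < snd ((h \<circ> Suc) j)"
        using val[of "Suc i" "Suc j"] by simp
    qed (simp add: mono)
    then show "\<not> avoids \<rho> T" using mem[of 0] by (auto simp: avoids_def)
  next
    assume "\<not> avoids \<rho> T"
    then obtain p f where p: "p \<in> T" and f: "occurs \<rho> f (NE T p)" by (auto simp: avoids_def)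
    then have "occurs (1 # map Suc \<rho>) (case_nat p f) T"
      using pos by (auto simp: occurs_def NE_def nth_Cons Suc_le_eq split: nat.splits)
    then show "\<exists>h. occurs (perm_sum [1] \<rho>) h T" using pi by auto
  qed
qed

lemma contained_in_perm_sum_iff:
  assumes "represents \<tau> f T" "is_perm \<rho>"
  shows "contained_in (perm_sum [1] \<rho>) \<tau> \<longleftrightarrow> \<not> avoids \<rho> T"
  using contained_in_iff_occurs[OF assms(1)] occurs_perm_sum_iff[OF assms(2)] by simp

lemma perm_points:
  assumes "is_perm \<sigma>"
  obtains f S where "represents \<sigma> f S" "gen_pos S"
proof -
  define f where "f i = (real i, real (\<sigma> ! i))" for i
  have "represents \<sigma> f (f ` {..<length \<sigma>})" by (auto simp: represents_def occurs_def f_def)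
  moreover have "gen_pos (f ` {..<length \<sigma>})"
    using assms by (auto simp: gen_pos_def inj_on_def f_def is_perm_def nth_eq_iff_index_eq)
  ultimately show ?thesis by (rule that)
qed

text \<open>Standardisation: the points are listed by first coordinate, and each is replaced by its
  rank in the second. The rank counts the point itself, so that values start at 1.\<close>

lemma points_perm:
  assumes "gen_pos T"
  obtains \<tau> f where "is_perm \<tau>" "represents \<tau> f T"
proof -
  define n where "n = card T"
  define xs where "xs = sorted_list_of_set (fst ` T)"
  define f where "f i = inv_into T fst (xs ! i)" for i
  define rank where "rank p = card {q \<in> T. snd q \<le> snd p}" for p :: point
  define \<tau> where "\<tau> = map (rank \<circ> f) [0..<n]"
  have fin: "finite T" and inj: "inj_on fst T" "inj_on snd T"
    using assms by (auto simp: gen_pos_def)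
  have len: "length xs = n" using fin inj by (simp add: xs_def n_def card_image)
  have setxs: "set xs = fst ` T" using fin by (simp add: xs_def)
  have xi: "xs ! i \<in> fst ` T" if "i < n" for i using that len setxs nth_mem by metis
  have fT: "f i \<in> T" and fx: "fst (f i) = xs ! i" if "i < n" for i
    using xi[OF that] by (auto simp: f_def inv_into_into f_inv_into_f)
  have mono: "fst (f i) < fst (f j)" if "i < j" "j < n" for i j
    using that fx len sorted_wrt_nth_less[of "(<)" xs i j] by (simp add: xs_def)
  have surj: "f ` {..<n} = T"
  proof
    show "f ` {..<n} \<subseteq> T" using fT by auto
    show "T \<subseteq> f ` {..<n}"
    proof
      fix p assume p: "p \<in> T"
      then have "fst p \<in> set xs" using setxs by auto
      then obtain i where i: "i < n" "xs ! i = fst p" using len by (metis in_set_conv_nth)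
      then have "f i = p" using inj p by (simp add: f_def)
      then show "p \<in> f ` {..<n}" using i by auto
    qed
  qed
  have rank_mono: "rank p < rank q" if "p \<in> T" "q \<in> T" "snd p < snd q" for p q
  proof -
    have "{r \<in> T. snd r \<le> snd p} \<subseteq> {r \<in> T. snd r \<le> snd q}" using that by auto
    moreover have "q \<in> {r \<in> T. snd r \<le> snd q}" "q \<notin> {r \<in> T. snd r \<le> snd p}" using that by auto
    ultimately show ?thesis unfolding rank_def using fin by (intro psubset_card_mono) auto
  qed
  have rank_iff: "rank p < rank q \<longleftrightarrow> snd p < snd q" if "p \<in> T" "q \<in> T" for p q
    using rank_mono[of p q] rank_mono[of q p] that inj(2)
    by (metis inj_onD less_asym linorder_less_linear)
  have nth: "\<tau> ! i = rank (f i)" if "i < n" for i using that by (simp add: \<tau>_def)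
  have lt: "length \<tau> = n" by (simp add: \<tau>_def)
  have occ: "occurs \<tau> f T"
    using fT mono rank_iff by (auto simp: occurs_def lt nth)
  have "inj_on rank T"
    using rank_mono inj(2) by (metis inj_onI inj_onD less_irrefl linorder_neqE_linordered_idom)
  moreover have "inj_on f {..<n}"
    using mono by (metis inj_onI lessThan_iff less_irrefl linorder_neqE_nat)
  ultimately have "inj_on (rank \<circ> f) {..<n}" using surj by (simp add: comp_inj_on)
  then have dist: "distinct \<tau>" by (simp add: \<tau>_def distinct_map atLeast0LessThan)
  have "rank p \<in> {1..n}" if "p \<in> T" for p
  proof -
    have "{q \<in> T. snd q \<le> snd p} \<noteq> {}" using that by blast
    then have "0 < rank p" unfolding rank_def using fin by (simp add: card_gt_0_iff)
    moreover have "rank p \<le> n" unfolding rank_def n_def using fin by (intro card_mono) auto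
    ultimately show ?thesis by simp
  qed
  then have "set \<tau> \<subseteq> {1..n}" using fT by (simp add: \<tau>_def image_subset_iff)
  moreover have "card (set \<tau>) = n" using distinct_card[OF dist] lt by simp
  ultimately have "set \<tau> = {1..n}" by (intro card_subset_eq) auto
  then have "is_perm \<tau>" using dist lt by (simp add: is_perm_def)
  moreover have "represents \<tau> f T" using occ surj lt by (simp add: represents_def)
  ultimately show ?thesis by (rule that)
qed

lemma represents_simple:
  assumes "is_perm \<tau>" and rep: "represents \<tau> f T"
    and simple: "\<And>J. interval_in T J \<Longrightarrow> J \<noteq> T \<Longrightarrow> card J \<le> 1"
  shows "simple_perm \<tau>"
  unfolding simple_perm_def
proof (intro conjI allI impI)
  let ?n = "length \<tau>"
  have mono: "fst (f i) < fst (f j)" if "i < j" "j < ?n" for i j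
    using rep that by (auto simp: represents_def occurs_def)
  have val: "\<tau> ! i < \<tau> ! j \<longleftrightarrow> snd (f i) < snd (f j)" if "i < ?n" "j < ?n" for i j
    using rep that by (auto simp: represents_def occurs_def)
  have fst_iff: "fst (f i) < fst (f j) \<longleftrightarrow> i < j" if "i < ?n" "j < ?n" for i j
    using mono[of i j] mono[of j i] that by (metis less_asym linorder_neqE_nat less_irrefl)
  have T: "T = f ` {..<?n}" using rep by (simp add: represents_def)
  have inj: "inj_on f {..<?n}"
    using mono by (metis inj_onI lessThan_iff less_irrefl linorder_neqE_nat)
  fix I assume "perm_interval \<tau> I"
  then obtain a b c d where I: "I \<subset> {..<?n}" "a \<le> b" "I = {a..b}" "(\<lambda>i. \<tau> ! i) ` I = {c..d}"
    unfolding perm_interval_def by blast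
  have In: "i < ?n" if "i \<in> I" for i using I(1) that by auto
  have "interval_in T (f ` I)"
    unfolding interval_in_def
  proof (intro conjI ballI)
    show "f ` I \<subseteq> T" using I(1) T by blast
    fix p u v assume "p \<in> T - f ` I" "u \<in> f ` I" "v \<in> f ` I"
    then obtain k i j where k: "p = f k" "k < ?n" "k \<notin> I" and i: "u = f i" "i \<in> I" and j: "v = f j" "j \<in> I"
      using T by blast
    show "\<not> (fst u < fst p \<and> fst p < fst v)"
      using fst_iff[of i k] fst_iff[of k j] k i j In I(3) by auto
    show "\<not> (snd u < snd p \<and> snd p < snd v)"
    proof
      assume "snd u < snd p \<and> snd p < snd v"
      then have "\<tau> ! i < \<tau> ! k" "\<tau> ! k < \<tau> ! j" using val k i j In by auto
      moreover have "\<tau> ! i \<in> {c..d}" "\<tau> ! j \<in> {c..d}" using I(4) i j by blast+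
      \<comment> \<open>The values on \<open>I\<close> fill the range from \<open>c\<close> to
        \<open>d\<close>, so a value in between is attained in \<open>I\<close>; distinctness then
        puts \<open>k\<close> into \<open>I\<close>.\<close>
      ultimately have "\<tau> ! k \<in> (\<lambda>i. \<tau> ! i) ` I" using I(4) by simp
      then obtain l where "l \<in> I" "\<tau> ! l = \<tau> ! k" by auto
      then show False using assms(1) k In[of l] by (auto simp: is_perm_def nth_eq_iff_index_eq)
    qed
  qed
  moreover have "f ` I \<noteq> T" using inj_on_image_eq_iff[OF inj, of I "{..<?n}"] I(1) T by auto
  ultimately have "card (f ` I) \<le> 1" by (rule simple)
  moreover have "card (f ` I) = card I" using inj I(1) by (intro card_image) (meson inj_on_subset psubset_imp_subset)
  moreover have "0 < card I" using I(2,3) by simp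
  ultimately show "card I = 1" by simp
qed (rule assms)

text \<open>A proper subclass \<open>D\<close> misses some \<sigma>. A simple \<tau> in
  \<open>C\<close> containing \<sigma> lies in the substitution closure of \<open>D\<close>, which
  has no further simple permutations, so \<tau> is in \<open>D\<close>, and with it
  \<sigma>.\<close>

lemma not_deflatableI:
  assumes "\<And>\<sigma>. \<sigma> \<in> C \<Longrightarrow> \<exists>\<tau>\<in>C. simple_perm \<tau> \<and> contained_in \<sigma> \<tau>" and "\<And>\<sigma>. \<sigma> \<in> C \<Longrightarrow> is_perm \<sigma>"
  shows "\<not> deflatable C"
proof
  assume "deflatable C"
  then obtain D where D: "perm_class D" "D \<subset> C" "C \<subseteq> subst_closure D"
    unfolding deflatable_def by blast
  then obtain \<sigma> where \<sigma>: "\<sigma> \<in> C" "\<sigma> \<notin> D" by blast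
  then obtain \<tau> where \<tau>: "\<tau> \<in> C" "simple_perm \<tau>" "contained_in \<sigma> \<tau>" using assms by blast
  then have "\<tau> \<in> simples (subst_closure D)" using D by (auto simp: simples_def)
  then have "\<tau> \<in> D" using subst_closure_class(2)[OF D(1)] by (auto simp: simples_def)
  then show False using D(1) \<tau> \<sigma> assms(2) unfolding perm_class_def by blast
qed

theorem theorem3p3:
  fixes \<pi> \<rho> :: "nat list"
  assumes "is_perm \<rho>"
    and "sum_indecomposable \<rho>"
    and "length \<rho> \<ge> 2" and "\<rho> ! 0 < \<rho> ! 1"
    and "\<pi> = perm_sum [1] \<rho>"
    and "(\<nexists>i. increasing_bond \<rho> i) \<or> (\<nexists>i. decreasing_bond \<rho> i)"
  shows "\<not> deflatable (Av \<pi>)"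
proof (rule not_deflatableI)
  \<comment> \<open>The only permutation of length 2 with an ascent is 12 = 1 \<oplus> 1, which is
    not sum-indecomposable.\<close>
  have "length \<rho> \<noteq> 2"
  proof
    assume 2: "length \<rho> = 2"
    then obtain x y where xy: "\<rho> = [x, y]" by (auto simp: numeral_2_eq_2 length_Suc_conv)
    have "{x, y} = {1..2}" using assms(1) xy by (simp add: is_perm_def)
    then have "x \<in> {1..2}" "y \<in> {1..2}" by blast+
    then have "\<rho> = perm_sum [1] [1]" using assms(4) xy by (auto simp: perm_sum_def)
    moreover have "is_perm [1]" by (auto simp: is_perm_def)
    ultimately show False using assms(2) unfolding sum_indecomposable_def by blast
  qed
  then have \<rho>3: "length \<rho> \<ge> 3" using assms(3) by simp
  fix \<sigma> assume \<sigma>: "\<sigma> \<in> Av \<pi>"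
  then obtain f S where S: "represents \<sigma> f S" "gen_pos S" using perm_points by (auto simp: Av_def)
  have "avoids \<rho> S"
    using contained_in_perm_sum_iff[OF S(1) assms(1)] \<sigma> assms(5) by (simp add: Av_def)
  then obtain T where T: "S \<subseteq> T" "gen_pos T" "avoids \<rho> T"
    "\<And>J. interval_in T J \<Longrightarrow> J \<noteq> T \<Longrightarrow> card J \<le> 1"
    using simple_extension[OF assms(1) \<rho>3 assms(4,6) S(2)] by blast
  obtain \<tau> h where \<tau>: "is_perm \<tau>" "represents \<tau> h T" using points_perm[OF T(2)] .
  have "\<tau> \<in> Av \<pi>"
    using contained_in_perm_sum_iff[OF \<tau>(2) assms(1)] T(3) \<tau>(1) assms(5) by (simp add: Av_def)
  moreover have "simple_perm \<tau>" using represents_simple[OF \<tau> T(4)] .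
  moreover have "contained_in \<sigma> \<tau>"
    using contained_in_iff_occurs[OF \<tau>(2)] S(1) occurs_mono[OF _ T(1)]
    unfolding represents_def by blast
  ultimately show "\<exists>\<tau>\<in>Av \<pi>. simple_perm \<tau> \<and> contained_in \<sigma> \<tau>" by blast
qed (auto simp: Av_def)

end
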